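(* Let $A[1\cdots n]$ be an array whose entries are independent uniform random real numbers in $[0,1)$. The expected effective entropy of 2-sided range maximum queries on $A$ (that is, queries for the position of the maximum of $A[j_1\cdots j_2]$, over all $1\le j_1\le j_2\le n$) is at most $cn+O(\log n)$ bits, where $$c \;=\; 2\sum_{k=1}^{\infty}\frac{\log k}{(k+1)(k+2)}\;\approx\;1.736\ldots$$
   Context: All logarithms are to base 2. For an array $A[1\cdots n]$ with distinct entries, the 1D range maximum query (1D-RMQ) with parameters $1\le j_1\le j_2\le n$ returns the index in $\{j_1,\dots,j_2\}$ at which $A$ attains its maximum over that range. Two arrays are equivalent with respect to a set of queries if they give the same answers to all queries in the set. An encoding maps arrays of known size to bit strings so that all queries in the set can be answered from the bit string alone, without access to the array. The expected effective entropy, for a random array, is the minimum over all uniquely decodable encodings of the expected number of bits used (expectation over the random array); up to an additive constant it is the Shannon entropy of the random equivalence class of the array. *)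

theory Defs
  imports "HOL-Probability.Probability"
begin

definition arrays :: "nat \<Rightarrow> (nat \<Rightarrow> real) set" where
  "arrays n = {A \<in> extensional {1..n}. inj_on A {1..n}}"

text \<open>
  Arrays have distinct entries on the queried range, so the position returned by
  the choice-based \<^const>\<open>arg_max_on\<close> is the unique one.
\<close>

definition rmq :: "(nat \<Rightarrow> real) \<Rightarrow> nat \<times> nat \<Rightarrow> nat" where
  "rmq A = (\<lambda>(j1, j2). arg_max_on A {j1..j2})"

definition two_sided_queries :: "nat \<Rightarrow> (nat \<times> nat) set" where
  "two_sided_queries n = {(j1, j2). 1 \<le> j1 \<and> j1 \<le> j2 \<and> j2 \<le> n}"

definition uniquely_decodable :: "bool list set \<Rightarrow> bool" where
  "uniquely_decodable C \<longleftrightarrow> inj_on concat (lists C)"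

definition random_array :: "nat \<Rightarrow> (nat \<Rightarrow> real) measure" where
  "random_array n = (\<Pi>\<^sub>M i\<in>{1..n}. uniform_measure lborel {0..<1})"

text \<open>
  The decoder \<open>d\<close> may depend on the size \<open>n\<close> but sees nothing of the array except its code.
  Measurability only serves to make the expected code length meaningful; arrays with repeated
  entries form a null set, on which no correctness is demanded.
\<close>

definition encodings :: "nat \<Rightarrow> (nat \<times> nat) set \<Rightarrow> ((nat \<Rightarrow> real) \<Rightarrow> bool list) set" where
  "encodings n Q = {e \<in> measurable (random_array n) (count_space UNIV).
     uniquely_decodable (e ` arrays n) \<and>
     (\<exists>d :: bool list \<Rightarrow> nat \<times> nat \<Rightarrow> nat. \<forall>A\<in>arrays n. \<forall>q\<in>Q. d (e A) q = rmq A q)}"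

definition expected_effective_entropy :: "nat \<Rightarrow> (nat \<times> nat) set \<Rightarrow> ennreal" where
  "expected_effective_entropy n Q =
     (INF e\<in>encodings n Q. \<integral>\<^sup>+ A. of_nat (length (e A)) \<partial>random_array n)"

text \<open>The series starts at \<open>k = 1\<close>, hence the shift.\<close>

definition c_term :: "nat \<Rightarrow> real" where
  "c_term k = log 2 (real (Suc k)) / ((real (Suc k) + 1) * (real (Suc k) + 2))"

definition c_RMQ :: real where
  "c_RMQ = 2 * (\<Sum>k. c_term k)"

end

theory Submission
  imports Defs "HOL-Library.Sublist" "HOL-Library.Tree"
begin

text \<open>
  The answers to all range maximum queries are determined by the shape of the Cartesian tree of the
  array. Give a shape \<open>t\<close> the weight \<open>\<Prod> 1 / size s\<close> over its nonempty subtrees \<open>s\<close>. The weights of the shapes of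
  size \<open>n\<close> add up to 1, so by Kraft's inequality there is a prefix code with word lengths at most
  \<open>2 + (\<Sum> log 2 (size s))\<close>. An interval of length \<open>k\<close> is the range of a subtree iff its (at most two)
  neighbours exceed all its entries. By exchangeability this has probability at most
  \<open>2 / ((k + 1) * (k + 2))\<close> for an inner interval and \<open>1 / (k + 1)\<close> for a proper prefix or suffix, and
  linearity of expectation yields \<open>(n + 1) * (\<Sum>k=1..<n. 2 * log 2 k / ((k + 1) * (k + 2))) + log 2 n + 2\<close>
  as a bound for the expected length.
\<close>

section \<open>Prefix codes\<close>

lemma card_bool_lists: "card {w :: bool list. length w = n} = 2 ^ n"
  using card_lists_length_eq[of "UNIV :: bool set" n] by simp

lemma finite_bool_lists: "finite {w :: bool list. length w = n}"
  using finite_lists_length_eq[of "UNIV :: bool set" n] by simp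

text \<open>Words are chosen greedily in order of increasing length: an earlier word of length
  \<open>l\<close> rules out \<open>2 ^ (len x - l)\<close> words of length \<open>len x\<close>,
  and a Kraft sum strictly below 1 leaves one of them free.\<close>

lemma kraft_prefix_code:
  fixes len :: "'a \<Rightarrow> nat"
  assumes "finite S" "(\<Sum>x\<in>S. (1 / 2) ^ len x) \<le> (1 :: real)"
  shows "\<exists>code :: 'a \<Rightarrow> bool list. (\<forall>x\<in>S. length (code x) = len x) \<and>
           (\<forall>x\<in>S. \<forall>y\<in>S. prefix (code x) (code y) \<longrightarrow> x = y)"
  using assms
proof (induction S rule: finite_ranking_induct[where f = len])
  case empty
  then show ?case by simp
next
  case (insert x S)
  show ?case
  proof (cases "x \<in> S")
    case True
    then show ?thesis using insert.IH insert.prems by (simp only: insert_absorb)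
  next
    case False
    have less: "(\<Sum>y\<in>S. (1 / 2) ^ len y) < (1 :: real)"
    proof -
      have "(1 / 2) ^ len x + (\<Sum>y\<in>S. (1 / 2) ^ len y) \<le> (1 :: real)"
        using insert.prems False insert.hyps(1) by simp
      moreover have "0 < (1 / 2 :: real) ^ len x" by simp
      ultimately show ?thesis by linarith
    qed
    then obtain code :: "'a \<Rightarrow> bool list" where code: "\<And>y. y \<in> S \<Longrightarrow> length (code y) = len y"
      "\<And>y z. y \<in> S \<Longrightarrow> z \<in> S \<Longrightarrow> prefix (code y) (code z) \<Longrightarrow> y = z"
      using insert.IH[OF less_imp_le[OF less]] by blast
    \<comment> \<open>These are the words of length \<open>len x\<close> that extend a word already
      in use.\<close>
    define blocked where "blocked = (\<Union>y\<in>S. (\<lambda>v. code y @ v) ` {v. length v = len x - len y})"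
    have "card blocked \<le> (\<Sum>y\<in>S. card ((\<lambda>v. code y @ v) ` {v. length v = len x - len y}))"
      unfolding blocked_def using insert.hyps(1) by (rule card_UN_le)
    also have "\<dots> = (\<Sum>y\<in>S. 2 ^ (len x - len y))"
      by (simp add: card_image card_bool_lists inj_on_def)
    finally have "real (card blocked) \<le> real (\<Sum>y\<in>S. 2 ^ (len x - len y))"
      by (simp only: of_nat_le_iff)
    also have "\<dots> = (\<Sum>y\<in>S. 2 ^ (len x - len y))" by simp
    also have "\<dots> = 2 ^ len x * (\<Sum>y\<in>S. (1 / 2) ^ len y)"
      unfolding sum_distrib_left using insert.hyps(2)
      by (intro sum.cong refl) (simp add: power_diff power_one_over divide_simps)
    also have "\<dots> < 2 ^ len x" using less by simp
    finally have "card blocked < card {w :: bool list. length w = len x}"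
      by (simp add: card_bool_lists)
    moreover have "finite blocked"
      unfolding blocked_def using insert.hyps(1) by (auto simp: finite_bool_lists)
    ultimately have "\<not> {w. length w = len x} \<subseteq> blocked"
      using card_mono[of blocked "{w. length w = len x}"] by auto
    then obtain w where w: "length w = len x" "w \<notin> blocked" by auto
    have not_prefix: "\<not> prefix (code y) w" if "y \<in> S" for y
    proof
      assume "prefix (code y) w"
      then obtain v where v: "w = code y @ v" by (auto simp: prefix_def)
      then have "length v = len x - len y" using w(1) code(1)[OF that] by simp
      then show False using v w(2) that by (auto simp: blocked_def)
    qed
    have not_prefix': "\<not> prefix w (code y)" if "y \<in> S" for y
    proof
      assume p: "prefix w (code y)"
      then obtain v where v: "code y = w @ v" by (auto simp: prefix_def)
      then have "length v = 0"
        using code(1)[OF that] insert.hyps(2)[OF that] w(1) arg_cong[OF v, of length]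
        unfolding length_append by linarith
      with v have "w = code y" by simp
      then show False using not_prefix[OF that] by simp
    qed
    have "length ((code(x := w)) y) = len y" if "y \<in> insert x S" for y
      using that w(1) code(1)[of y] by (cases "y = x") simp_all
    moreover have "y = z"
      if "y \<in> insert x S" "z \<in> insert x S" "prefix ((code(x := w)) y) ((code(x := w)) z)" for y z
      using that code(2)[of y z] not_prefix[of y] not_prefix'[of z]
      by (cases "y = x"; cases "z = x") simp_all
    ultimately show ?thesis by blast
  qed
qed

text \<open>The first words of two equal concatenations are comparable under \<open>prefix\<close>,
  hence equal, and can be cancelled. The empty word must be excluded, since \<open>[]\<close> and
  \<open>[[]]\<close> have the same concatenation.\<close>

lemma uniquely_decodable_prefix_code:
  assumes pre: "\<And>u v. u \<in> C \<Longrightarrow> v \<in> C \<Longrightarrow> prefix u v \<Longrightarrow> u = v" and nonempty: "[] \<notin> C"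
  shows "uniquely_decodable C"
  unfolding uniquely_decodable_def
proof (rule inj_onI)
  fix us vs assume "us \<in> lists C" "vs \<in> lists C" "concat us = concat vs"
  then show "us = vs"
  proof (induction arbitrary: vs rule: lists.induct)
    case Nil
    then show ?case using nonempty by (cases vs) auto
  next
    case (Cons u us)
    then obtain v vs' where vs: "vs = v # vs'" using nonempty by (cases vs) auto
    have "prefix u v \<or> prefix v u"
      using \<open>concat (u # us) = concat vs\<close> vs by (auto simp: append_eq_append_conv2 prefix_def)
    moreover have "u \<in> C" "v \<in> C" using Cons.hyps Cons.prems vs by auto
    ultimately have "u = v" using pre by blast
    moreover from this have "us = vs'"
      using Cons.prems vs by (intro Cons.IH) auto
    ultimately show ?case using vs by simp
  qed
qed

section \<open>Cartesian trees\<close>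

abbreviation shapes :: "nat \<Rightarrow> unit tree set" where
  "shapes n \<equiv> {t. size t = n}"

text \<open>
  The probability that the Cartesian tree of a random array has the given shape: the root
  position is uniform, and the two sides are independent. Only the total mass 1 is needed.
\<close>

fun weight :: "unit tree \<Rightarrow> real" where
  "weight \<langle>\<rangle> = 1"
| "weight \<langle>l, _, r\<rangle> = weight l * weight r / real (Suc (size l + size r))"

lemma weight_pos: "weight t > 0"
  by (induction t) auto

lemma shapes_0: "shapes 0 = {\<langle>\<rangle>}"
  by auto

lemma shapes_Suc: "shapes (Suc n) = (\<Union>k\<le>n. (\<lambda>(l, r). \<langle>l, (), r\<rangle>) ` (shapes k \<times> shapes (n - k)))"
proof (intro equalityI subsetI)
  fix t assume "t \<in> shapes (Suc n)"
  then obtain l r where "t = \<langle>l, (), r\<rangle>" "size l + size r = n" by (cases t) auto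
  then show "t \<in> (\<Union>k\<le>n. (\<lambda>(l, r). \<langle>l, (), r\<rangle>) ` (shapes k \<times> shapes (n - k)))"
    by (intro UN_I[of "size l"]) auto
qed auto

lemma finite_shapes: "finite (shapes n)"
proof (induction n rule: less_induct)
  case (less n)
  then show ?case by (cases n) (auto simp: shapes_0 shapes_Suc)
qed

text \<open>Split by the size \<open>k\<close> of the left subtree: by induction each of the
  \<open>m + 1\<close> values of \<open>k\<close> contributes \<open>1 / (m + 1)\<close>.\<close>

lemma sum_weight: "(\<Sum>t\<in>shapes n. weight t) = 1"
proof (induction n rule: less_induct)
  case (less n)
  show ?case
  proof (cases n)
    case 0
    then show ?thesis by (simp add: shapes_0)
  next
    case (Suc m)
    have "(\<Sum>t\<in>shapes n. weight t) =
        (\<Sum>k\<le>m. \<Sum>t\<in>(\<lambda>(l, r). \<langle>l, (), r\<rangle>) ` (shapes k \<times> shapes (m - k)). weight t)"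
      unfolding Suc shapes_Suc by (rule sum.UNION_disjoint) (auto simp: finite_shapes)
    also have "\<dots> = (\<Sum>k\<le>m. \<Sum>(l, r)\<in>shapes k \<times> shapes (m - k). weight \<langle>l, (), r\<rangle>)"
      by (intro sum.cong refl, subst sum.reindex) (auto simp: inj_on_def case_prod_unfold)
    also have "\<dots> = (\<Sum>k\<le>m. (\<Sum>l\<in>shapes k. weight l) * (\<Sum>r\<in>shapes (m - k). weight r) / real (Suc m))"
      unfolding sum_product sum.cartesian_product sum_divide_distrib
      by (intro sum.cong refl) auto
    also have "\<dots> = 1" using less Suc by simp
    finally show ?thesis .
  qed
qed

text \<open>The inequality is strict, so the shape is unique, but some arrays with repeated entries have none.\<close>

fun cartesian :: "(nat \<Rightarrow> real) \<Rightarrow> nat \<Rightarrow> unit tree \<Rightarrow> bool" where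
  "cartesian A i \<langle>\<rangle> \<longleftrightarrow> True"
| "cartesian A i \<langle>l, _, r\<rangle> \<longleftrightarrow>
     (\<forall>j\<in>{i..<i + Suc (size l + size r)} - {i + size l}. A j < A (i + size l)) \<and>
     cartesian A i l \<and> cartesian A (Suc (i + size l)) r"

lemma cartesian_exists:
  assumes "inj_on A {i..<i + n}"
  shows "\<exists>t\<in>shapes n. cartesian A i t"
  using assms
proof (induction n arbitrary: i rule: less_induct)
  case (less n)
  show ?case
  proof (cases "n = 0")
    case False
    then have "Max (A ` {i..<i + n}) \<in> A ` {i..<i + n}" by (intro Max_in) auto
    then obtain m where m: "m \<in> {i..<i + n}" "A m = Max (A ` {i..<i + n})" by auto
    then have "A j \<le> A m" if "j \<in> {i..<i + n}" for j using that by simp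
    then have max: "A j < A m" if "j \<in> {i..<i + n} - {m}" for j
      using that m(1) less.prems by (metis DiffE inj_on_eq_iff less_eq_real_def singletonI)
    have "inj_on A {i..<i + (m - i)}" "inj_on A {Suc m..<Suc m + (i + n - Suc m)}"
      using m(1) by (auto intro!: inj_on_subset[OF less.prems])
    moreover have sizes: "m - i < n" "i + n - Suc m < n" using m(1) by auto
    ultimately obtain l r where lr: "size l = m - i" "cartesian A i l" "size r = i + n - Suc m" "cartesian A (Suc m) r"
      using less.IH[of "m - i" i] less.IH[of "i + n - Suc m" "Suc m"] sizes by auto
    then show ?thesis using m(1) max by (intro bexI[of _ "\<langle>l, (), r\<rangle>"]) auto
  qed (auto intro: bexI[of _ "\<langle>\<rangle>"])
qed

text \<open>The root sits at the unique strict maximum; different left sizes would give two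
  positions whose entries exceed each other.\<close>

lemma cartesian_unique:
  assumes "cartesian A i s" "cartesian A i t" "size s = size t"
  shows "s = t"
  using assms
proof (induction s arbitrary: i t)
  case (Node l u r)
  then obtain l' r' where t: "t = \<langle>l', (), r'\<rangle>" by (cases t) auto
  have "size l = size l'"
  proof (rule ccontr)
    assume "size l \<noteq> size l'"
    then have "A (i + size l) < A (i + size l')" "A (i + size l') < A (i + size l)"
      using Node.prems t by auto
    then show False by simp
  qed
  then show ?case using Node t by auto
qed auto

section \<open>Answering queries from the shape alone\<close>

lemma rmq_eqI:
  assumes "a \<le> m" "m \<le> b" "\<And>j. a \<le> j \<Longrightarrow> j \<le> b \<Longrightarrow> j \<noteq> m \<Longrightarrow> A j < A m"
  shows "rmq A (a, b) = m"
proof -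
  have "is_arg_max A (\<lambda>x. x \<in> {a..b}) x \<longleftrightarrow> x = m" for x
    using assms by (fastforce simp: is_arg_max_linorder not_le[symmetric] dest: less_imp_le)
  then have "is_arg_max A (\<lambda>x. x \<in> {a..b}) = (\<lambda>x. x = m)" by (rule ext)
  then show ?thesis unfolding rmq_def arg_max_on_def arg_max_def by simp
qed

text \<open>The descent stops at the first root inside the query range, the lowest common ancestor
  of its end points. The value 0 at a leaf is a dummy: a nonempty query within the range of the tree
  meets such a root first.\<close>

fun shape_rmq :: "nat \<Rightarrow> unit tree \<Rightarrow> nat \<times> nat \<Rightarrow> nat" where
  "shape_rmq i \<langle>\<rangle> q = 0"
| "shape_rmq i \<langle>l, _, r\<rangle> (a, b) =
     (if b < i + size l then shape_rmq i l (a, b)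
      else if i + size l < a then shape_rmq (Suc (i + size l)) r (a, b)
      else i + size l)"

lemma shape_rmq_eq_rmq:
  assumes "cartesian A i t" "i \<le> a" "a \<le> b" "b < i + size t"
  shows "shape_rmq i t (a, b) = rmq A (a, b)"
  using assms
proof (induction t arbitrary: i)
  case (Node l u r)
  show ?case
  proof (cases "a \<le> i + size l \<and> i + size l \<le> b")
    case True
    then show ?thesis using Node.prems by (auto intro!: rmq_eqI[symmetric])
  next
    case False
    then show ?thesis using Node by auto
  qed
qed auto

section \<open>Subtree ranges as dominated intervals\<close>

definition border :: "nat \<Rightarrow> nat \<Rightarrow> nat \<times> nat \<Rightarrow> nat set" where
  "border i n = (\<lambda>(a, b). {x \<in> {i..<i + n}. Suc x = a \<or> x = Suc b})"

definition intervals :: "nat \<Rightarrow> nat \<Rightarrow> (nat \<times> nat) set" where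
  "intervals i n = {(a, b). i \<le> a \<and> a \<le> b \<and> b < i + n}"

text \<open>
  The dominated intervals are exactly the index ranges of the nonempty subtrees of the Cartesian
  tree. The whole range has an empty border and is therefore always dominated.
\<close>

definition dominated :: "(nat \<Rightarrow> real) \<Rightarrow> nat \<Rightarrow> nat \<Rightarrow> nat \<times> nat \<Rightarrow> bool" where
  "dominated A i n = (\<lambda>(a, b). \<forall>x\<in>border i n (a, b). \<forall>y\<in>{a..b}. A y < A x)"

lemma finite_intervals: "finite (intervals i n)"
  by (rule finite_subset[of _ "{i..<i + n} \<times> {i..<i + n}"]) (auto simp: intervals_def)

text \<open>The guard \<open>i < a\<close> makes \<open>a - 1\<close> a true predecessor;
  \<open>border\<close> says \<open>Suc x = a\<close> because truncated subtraction would make 0 its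
  own left neighbour.\<close>

lemma dominated_iff:
  assumes "(a, b) \<in> intervals i n"
  shows "dominated A i n (a, b) \<longleftrightarrow> (i < a \<longrightarrow> (\<forall>y\<in>{a..b}. A y < A (a - 1))) \<and>
     (Suc b < i + n \<longrightarrow> (\<forall>y\<in>{a..b}. A y < A (Suc b)))"
proof -
  have "border i n (a, b) = (if i < a then {a - 1} else {}) \<union> (if Suc b < i + n then {Suc b} else {})"
    using assms by (auto simp: border_def intervals_def)
  then show ?thesis by (auto simp: dominated_def)
qed

text \<open>An interval that avoids the root position lies on one side of it, and the root as a
  neighbour exceeds all its entries anyway. An interval that contains the root has no larger
  neighbour, so it is dominated only if it is the whole range.\<close>

lemma dominated_intervals_Node:
  assumes "cartesian A i \<langle>l, u, r\<rangle>"
  defines "n \<equiv> Suc (size l + size r)"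
  shows "{I \<in> intervals i n. dominated A i n I} =
    {I \<in> intervals i (size l). dominated A i (size l) I} \<union>
    {I \<in> intervals (Suc (i + size l)) (size r). dominated A (Suc (i + size l)) (size r) I} \<union> {(i, i + n - 1)}"
proof -
  define m where "m = i + size l"
  have max: "A j < A m" if "j \<in> {i..<i + n}" "j \<noteq> m" for j
    using assms that by (auto simp: m_def)
  have "(I \<in> intervals i n \<and> dominated A i n I) \<longleftrightarrow>
     (I \<in> intervals i (size l) \<and> dominated A i (size l) I) \<or>
     (I \<in> intervals (Suc m) (size r) \<and> dominated A (Suc m) (size r) I) \<or> I = (i, i + n - 1)" for I
  proof (cases I)
    case [simp]: (Pair a b)
    consider "(a, b) \<notin> intervals i n" | "(a, b) \<in> intervals i n" "b < m" | "(a, b) \<in> intervals i n" "m < a"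
      | "(a, b) \<in> intervals i n" "a \<le> m" "m \<le> b" by linarith
    then show ?thesis
    proof cases
      case 1
      then show ?thesis by (auto simp: intervals_def n_def m_def)
    next
      case 2
      then have l: "(a, b) \<in> intervals i (size l)" and "(a, b) \<notin> intervals (Suc m) (size r)" "b \<noteq> i + n - 1"
        by (auto simp: intervals_def n_def m_def)
      \<comment> \<open>An interval that ends right before the root gains \<open>m\<close> as a
        neighbour when the range grows from the left side to the whole.\<close>
      moreover have "Suc b = m" if "\<not> Suc b < i + size l" using that 2 by (auto simp: m_def)
      moreover have "A y < A m" if "y \<in> {a..b}" for y using max[of y] that 2 by (auto simp: intervals_def)
      moreover have "Suc b < i + n" using 2 by (auto simp: m_def n_def)
      ultimately show ?thesis
        using 2 unfolding Pair dominated_iff[OF l] dominated_iff[OF 2(1)] by auto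
    next
      case 3
      then have r: "(a, b) \<in> intervals (Suc m) (size r)" and "(a, b) \<notin> intervals i (size l)" "a \<noteq> i"
        by (auto simp: intervals_def n_def m_def)
      moreover have "a - 1 = m" if "\<not> Suc m < a" using that 3 by auto
      moreover have "A y < A m" if "y \<in> {a..b}" for y using max[of y] that 3 by (auto simp: intervals_def)
      moreover have "Suc m + size r = i + n" "i < a" using 3 by (auto simp: m_def n_def)
      ultimately show ?thesis
        using 3 unfolding Pair dominated_iff[OF r] dominated_iff[OF 3(1)] by auto
    next
      case 4
      then have "(a, b) \<notin> intervals (Suc m) (size r)" "(a, b) \<notin> intervals i (size l)"
        by (auto simp: intervals_def m_def)
      moreover have "A (a - 1) < A m" if "i < a" by (rule max) (use 4 that in \<open>auto simp: intervals_def\<close>)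
      then have "\<not> A m < A (a - 1)" if "i < a" using that by fastforce
      moreover have "A (Suc b) < A m" if "Suc b < i + n" by (rule max) (use 4 that in \<open>auto simp: intervals_def\<close>)
      then have "\<not> A m < A (Suc b)" if "Suc b < i + n" using that by fastforce
      moreover have "b = i + n - 1 \<longleftrightarrow> \<not> Suc b < i + n" "a = i \<longleftrightarrow> \<not> i < a" using 4 by (auto simp: intervals_def)
      ultimately show ?thesis
        using 4 unfolding Pair dominated_iff[OF 4(1)] by auto
    qed
  qed
  then show ?thesis unfolding m_def by blast
qed

text \<open>Turns the ideal code length of a shape into a sum over intervals, to which linearity of
  expectation applies. Each root adds the logarithm of its subtree size, which is the length of the
  interval that the subtree covers.\<close>

lemma log_weight:
  assumes "cartesian A i t"
  shows "- log 2 (weight t) =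
    (\<Sum>(a, b)\<in>{I \<in> intervals i (size t). dominated A i (size t) I}. log 2 (real (Suc b - a)))"
  using assms
proof (induction t arbitrary: i)
  case Leaf
  have "intervals i 0 = {}" by (auto simp: intervals_def)
  then show ?case by simp
next
  case (Node l u r)
  let ?D = "\<lambda>i n. {I \<in> intervals i n. dominated A i n I}"
  let ?f = "\<lambda>(a, b). log 2 (real (Suc b - a))"
  define n where "n = Suc (size l + size r)"
  define m where "m = i + size l"
  have fin: "finite (?D j k)" for j k using finite_intervals by simp
  have "?D i n = (?D i (size l) \<union> ?D (Suc m) (size r)) \<union> {(i, i + n - 1)}"
    using dominated_intervals_Node[OF Node.prems] by (simp add: n_def m_def)
  moreover have "(?D i (size l) \<union> ?D (Suc m) (size r)) \<inter> {(i, i + n - 1)} = {}" "?D i (size l) \<inter> ?D (Suc m) (size r) = {}"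
    by (auto simp: intervals_def n_def m_def)
  ultimately have "sum ?f (?D i n) = sum ?f (?D i (size l)) + sum ?f (?D (Suc m) (size r)) + log 2 (real n)"
    using fin by (simp add: sum.union_disjoint n_def)
  also have "\<dots> = - log 2 (weight l) - log 2 (weight r) + log 2 (real n)"
    using Node.IH(1)[of i] Node.IH(2)[of "Suc m"] Node.prems by (simp add: m_def)
  also have "\<dots> = - log 2 (weight \<langle>l, u, r\<rangle>)"
    using weight_pos[of l] weight_pos[of r]
    by (simp add: log_divide_pos log_mult_pos n_def del: of_nat_Suc of_nat_add)
  finally show ?case by (simp add: n_def)
qed

section \<open>Exchangeability\<close>

lemma prob_space_random_array: "prob_space (random_array n)"
  unfolding random_array_def by (intro prob_space_PiM prob_space_uniform_measure) auto

lemma space_random_array: "space (random_array n) = extensional {1..n}"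
  by (simp add: random_array_def space_PiM PiE_def)

lemma pred_less_random_array:
  assumes "i \<in> {1..n}" "j \<in> {1..n}"
  shows "Measurable.pred (random_array n) (\<lambda>A. A i < A j)"
proof -
  have "(\<lambda>A. A k) \<in> borel_measurable (random_array n)" if "k \<in> {1..n}" for k
    using measurable_component_singleton[OF that, of "\<lambda>_. uniform_measure lborel {0..<1}"]
    unfolding random_array_def by (simp cong: measurable_cong_sets)
  then show ?thesis using assms by (intro borel_measurable_pred_less) auto
qed

definition tops :: "nat \<Rightarrow> nat set \<Rightarrow> nat set \<Rightarrow> (nat \<Rightarrow> real) set" where
  "tops n S B = {A \<in> space (random_array n). \<forall>x\<in>B. \<forall>y\<in>S - B. A y < A x}"

lemma sets_tops:
  assumes "S \<subseteq> {1..n}" "B \<subseteq> S"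
  shows "tops n S B \<in> sets (random_array n)"
proof -
  have "finite S" using finite_subset[OF assms(1)] by simp
  then have "finite B" "finite (S - B)" using finite_subset[OF assms(2)] by simp_all
  then show ?thesis
    unfolding tops_def using assms
    by (intro sets.sets_Collect_finite_All predE pred_less_random_array) auto
qed

text \<open>A permutation of the positions that carries \<open>B\<close> to \<open>B'\<close> and
  preserves \<open>S\<close> leaves the product of identical measures invariant.\<close>

lemma measure_tops_eq:
  assumes S: "S \<subseteq> {1..n}" and B: "B \<subseteq> S" "B' \<subseteq> S" "card B' = card B"
  shows "measure (random_array n) (tops n S B') = measure (random_array n) (tops n S B)"
proof -
  have fin: "finite S" using S by (rule finite_subset) simp
  then have "finite B" "finite B'" using B by (auto intro: finite_subset)
  then obtain g h where g: "bij_betw g B B'" and h: "bij_betw h (S - B) (S - B')"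
    using B fin finite_same_card_bij[of B B'] finite_same_card_bij[of "S - B" "S - B'"]
    by (auto simp: card_Diff_subset)
  \<comment> \<open>Glues the bijections \<open>B\<close> to \<open>B'\<close> and
    \<open>S - B\<close> to \<open>S - B'\<close> and fixes everything outside
    \<open>S\<close>.\<close>
  define f where "f x = (if x \<in> B then g x else if x \<in> S then h x else x)" for x
  have "f ` B = g ` B" "f ` (S - B) = h ` (S - B)"
    by (rule image_cong; simp add: f_def)+
  then have img: "f ` B = B'" "f ` (S - B) = S - B'"
    using g h by (simp_all only: bij_betw_def)
  have SB: "B \<union> (S - B) = S" using B by blast
  have "f ` S = B' \<union> (S - B')" using image_Un[of f B "S - B"] by (simp only: SB img)
  then have fS: "f ` S = S" using B(2) by blast
  have "inj_on f B" "inj_on f (S - B)"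
    using g h by (auto simp: f_def bij_betw_def inj_on_def)
  then have "inj_on f (B \<union> (S - B))" using img by (subst inj_on_Un) auto
  moreover have id: "f x = x" if "x \<in> {1..n} - S" for x using that B by (auto simp: f_def)
  ultimately have "inj_on f (S \<union> ({1..n} - S))"
    using fS by (subst inj_on_Un) (auto simp: SB inj_on_def)
  then have inj: "inj_on f {1..n}" using S by (simp add: Un_absorb1)
  have maps: "f \<in> {1..n} \<rightarrow> {1..n}"
  proof
    fix x assume "x \<in> {1..n}"
    then show "f x \<in> {1..n}" using fS id[of x] S by (cases "x \<in> S") (blast, simp)
  qed
  let ?U = "uniform_measure lborel {0..<1::real}"
  let ?T = "\<lambda>A. \<lambda>j\<in>{1..n}. A (f j) :: real"
  have U: "prob_space ?U" by (intro prob_space_uniform_measure) auto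
  have distr: "distr (random_array n) (random_array n) ?T = random_array n"
    unfolding random_array_def
    using distr_PiM_reindex[where M = "\<lambda>_. ?U", OF _ inj maps] U by simp
  have "?T \<in> measurable (random_array n) (random_array n)"
    unfolding random_array_def using maps
    by (intro measurable_restrict measurable_component_singleton) auto
  then have "measure (random_array n) (tops n S B) =
      measure (random_array n) (?T -` tops n S B \<inter> space (random_array n))"
    using sets_tops[OF S B(1)] by (subst distr[symmetric]) (simp add: measure_distr)
  \<comment> \<open>The permuted array has \<open>B\<close> on top of \<open>S\<close> iff the
    original has the image \<open>B'\<close> on top of the image \<open>S\<close>.\<close>
  also have "?T -` tops n S B \<inter> space (random_array n) = tops n S B'"
  proof -
    have "(\<forall>x\<in>f ` B. \<forall>y\<in>f ` (S - B). A y < A x) \<longleftrightarrow> (\<forall>x\<in>B. \<forall>y\<in>S - B. A (f y) < A (f x))"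
      for A :: "nat \<Rightarrow> real" by auto
    moreover have "B \<subseteq> {1..n}" "S - B \<subseteq> {1..n}" using S B by auto
    ultimately show ?thesis
      unfolding tops_def space_random_array img by (auto simp: subset_iff)
  qed
  finally show ?thesis by simp
qed

text \<open>By exchangeability each of the \<open>card S choose card B\<close> subsets is equally likely to carry the
  largest entries of \<open>S\<close>, and the corresponding events are disjoint.\<close>

lemma measure_tops_le:
  assumes S: "S \<subseteq> {1..n}" and B: "B \<subseteq> S"
  shows "measure (random_array n) (tops n S B) \<le> 1 / real (card S choose card B)"
proof -
  interpret prob_space "random_array n" by (rule prob_space_random_array)
  let ?F = "{B'. B' \<subseteq> S \<and> card B' = card B}"
  have fin: "finite S" using S by (rule finite_subset) simp
  have "disjoint_family_on (tops n S) ?F"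
    unfolding disjoint_family_on_def
  proof (intro ballI impI)
    fix B1 B2
    assume *: "B1 \<in> ?F" "B2 \<in> ?F" "B1 \<noteq> B2"
    then have "finite B1" "finite B2" using fin by (auto intro: finite_subset)
    \<comment> \<open>Sets of equal size that differ do not contain each other, so each has an
      element outside the other, and the two entries would have to exceed one another.\<close>
    then have "\<not> B1 \<subseteq> B2" "\<not> B2 \<subseteq> B1" using * card_subset_eq[of B2 B1] card_subset_eq[of B1 B2] by auto
    then obtain y z where yz: "y \<in> B1 - B2" "z \<in> B2 - B1" by blast
    have "A y < A z \<and> A z < A y" if "A \<in> tops n S B1 \<inter> tops n S B2" for A
      using that yz * unfolding tops_def by blast
    then show "tops n S B1 \<inter> tops n S B2 = {}" by (meson equals0I less_asym)
  qed
  then have "(\<Sum>B'\<in>?F. prob (tops n S B')) = prob (\<Union>B'\<in>?F. tops n S B')"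
    using fin sets_tops[OF S] by (intro finite_measure_finite_Union[symmetric]) auto
  also have "\<dots> \<le> 1" by (rule prob_le_1)
  also have "(\<Sum>B'\<in>?F. prob (tops n S B')) = real (card S choose card B) * prob (tops n S B)"
    using measure_tops_eq[OF S B] fin by (simp add: n_subsets)
  moreover have "card S choose card B > 0" using card_mono[OF fin B] by simp
  ultimately show ?thesis by (simp add: field_simps)
qed

section \<open>The constant\<close>

text \<open>By convexity of \<open>1 / x\<close>, the trapezoidal rule overestimates its integral
  from \<open>k\<close> to \<open>k + 1\<close>; the midpoint rule of the next lemma underestimates
  it.\<close>

lemma ln_Suc_diff_le:
  assumes "k > 0"
  shows "ln (real (Suc k)) - ln (real k) \<le> (1 / real k + 1 / real (Suc k)) / 2"
  using ln_inverse_approx_le[of "real k" 1] assms by (simp add: field_simps)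

lemma ln_Suc_diff_ge:
  assumes "k > 0"
  shows "2 / (2 * real k + 1) \<le> ln (real (Suc k)) - ln (real k)"
  using ln_inverse_approx_ge[of "real k" "real (Suc k)"] assms by (simp add: field_simps)

text \<open>
  Summation by parts turns the tail of the series from \<open>k\<close> on into \<open>log 2 k / (k + 1)\<close> plus the tail of
  \<open>log 2 (1 + 1 / k) / (k + 2)\<close>. The trapezoidal bound on \<open>ln (1 + 1 / k)\<close> gives terms that telescope
  exactly; after the midpoint bound, \<open>(k + 1 / 2) * (k + 2) \<le> (k + 3 / 4) * (k + 7 / 4)\<close> makes them telescope.
\<close>

definition tail_upper :: "nat \<Rightarrow> real" where
  "tail_upper k = log 2 k / (k + 1) + (1 / (4 * k) + 3 / (4 * (k + 1))) / ln 2"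

definition tail_lower :: "nat \<Rightarrow> real" where
  "tail_lower k = log 2 k / (k + 1) + (1 / (k + 3 / 4)) / ln 2"

lemma c_term_le: "c_term k \<le> tail_upper (Suc k) - tail_upper (Suc (Suc k))"
proof -
  define x where "x = real (Suc k)"
  have x: "x > 0" "real (Suc (Suc k)) = x + 1" by (simp_all add: x_def)
  have "(ln (x + 1) - ln x) / (x + 2) \<le> ((1 / x + 1 / (x + 1)) / 2) / (x + 2)"
    using ln_Suc_diff_le[of "Suc k"] x unfolding x_def[symmetric]
    by (intro divide_right_mono) auto
  \<comment> \<open>Both sides have the partial fractions
    \<open>1 / (4 * x) + 1 / (2 * (x + 1)) - 3 / (4 * (x + 2))\<close>.\<close>
  also have "\<dots> = (1 / (4 * x) + 3 / (4 * (x + 1))) - (1 / (4 * (x + 1)) + 3 / (4 * (x + 2)))"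
    using x(1) by (simp add: divide_simps) (simp add: algebra_simps)
  finally have "((ln (x + 1) - ln x) / (x + 2)) / ln 2 \<le>
     ((1 / (4 * x) + 3 / (4 * (x + 1))) - (1 / (4 * (x + 1)) + 3 / (4 * (x + 2)))) / ln 2"
    by (intro divide_right_mono) auto
  moreover have "ln x / ((x + 1) * (x + 2)) = ln x / (x + 1) - ln (x + 1) / (x + 2) + (ln (x + 1) - ln x) / (x + 2)"
    using x(1) by (simp add: divide_simps) (simp add: algebra_simps)
  then have "(ln x / ((x + 1) * (x + 2))) / ln 2 =
     (ln x / (x + 1) - ln (x + 1) / (x + 2) + (ln (x + 1) - ln x) / (x + 2)) / ln 2"
    by simp
  ultimately show ?thesis
    unfolding c_term_def tail_upper_def x x_def[symmetric] log_def
    by (simp add: add_divide_distrib diff_divide_distrib add.assoc mult.commute)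
qed

lemma c_term_ge: "tail_lower (Suc k) - tail_lower (Suc (Suc k)) \<le> c_term k"
proof -
  define x where "x = real (Suc k)"
  have x: "x > 0" "real (Suc (Suc k)) = x + 1" by (simp_all add: x_def)
  \<comment> \<open>The shifts differ by 1 and add up to 5/2, so both quadratic denominators have
    the same linear coefficient.\<close>
  have "1 / (x + 3 / 4) - 1 / (x + 7 / 4) \<le> (2 / (2 * x + 1)) / (x + 2)"
    using x(1) by (simp add: divide_simps) (simp add: algebra_simps)
  also have "\<dots> \<le> (ln (x + 1) - ln x) / (x + 2)"
    using ln_Suc_diff_ge[of "Suc k"] x unfolding x_def[symmetric]
    by (intro divide_right_mono) auto
  finally have "(1 / (x + 3 / 4) - 1 / (x + 7 / 4)) / ln 2 \<le> ((ln (x + 1) - ln x) / (x + 2)) / ln 2"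
    by (intro divide_right_mono) auto
  moreover have "ln x / ((x + 1) * (x + 2)) = ln x / (x + 1) - ln (x + 1) / (x + 2) + (ln (x + 1) - ln x) / (x + 2)"
    using x(1) by (simp add: divide_simps) (simp add: algebra_simps)
  then have "(ln x / ((x + 1) * (x + 2))) / ln 2 =
     (ln x / (x + 1) - ln (x + 1) / (x + 2) + (ln (x + 1) - ln x) / (x + 2)) / ln 2"
    by simp
  ultimately show ?thesis
    unfolding c_term_def tail_lower_def x x_def[symmetric] log_def
    by (simp add: add_divide_distrib diff_divide_distrib add.assoc mult.commute)
qed

lemma tail_upper_tendsto_0: "tail_upper \<longlonglongrightarrow> 0"
  unfolding tail_upper_def by real_asymp

lemma tail_lower_tendsto_0: "tail_lower \<longlonglongrightarrow> 0"
  unfolding tail_lower_def by real_asymp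

lemma c_term_nonneg: "c_term k \<ge> 0"
  by (simp add: c_term_def)

lemma tail_upper_sums: "(\<lambda>k. tail_upper (Suc (k + m)) - tail_upper (Suc (Suc (k + m)))) sums tail_upper (Suc m)"
  using telescope_sums'[OF LIMSEQ_ignore_initial_segment[OF tail_upper_tendsto_0, of "Suc m"]]
  by simp

lemma tail_lower_sums: "(\<lambda>k. tail_lower (Suc (k + m)) - tail_lower (Suc (Suc (k + m)))) sums tail_lower (Suc m)"
  using telescope_sums'[OF LIMSEQ_ignore_initial_segment[OF tail_lower_tendsto_0, of "Suc m"]]
  by simp

lemma summable_c_term: "summable c_term"
  using tail_upper_sums[of 0] c_term_le c_term_nonneg
  by (intro summable_comparison_test'[of _ 0 c_term]) (auto simp: sums_iff)

lemma c_RMQ_bounds: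
  "2 * ((\<Sum>k<m. c_term k) + tail_lower (Suc m)) \<le> c_RMQ"
  "c_RMQ \<le> 2 * ((\<Sum>k<m. c_term k) + tail_upper (Suc m))"
proof -
  have s: "summable (\<lambda>k. c_term (k + m))"
    using summable_c_term by (rule summable_ignore_initial_segment)
  have "tail_lower (Suc m) \<le> (\<Sum>k. c_term (k + m))"
    using sums_le[OF _ tail_lower_sums summable_sums[OF s]] c_term_ge by simp
  moreover have "(\<Sum>k. c_term (k + m)) \<le> tail_upper (Suc m)"
    using sums_le[OF _ summable_sums[OF s] tail_upper_sums] c_term_le by simp
  moreover have "c_RMQ = 2 * ((\<Sum>k. c_term (k + m)) + (\<Sum>k<m. c_term k))"
    unfolding c_RMQ_def using suminf_split_initial_segment[OF summable_c_term, of m] by simp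
  ultimately show "2 * ((\<Sum>k<m. c_term k) + tail_lower (Suc m)) \<le> c_RMQ"
    "c_RMQ \<le> 2 * ((\<Sum>k<m. c_term k) + tail_upper (Suc m))" by simp_all
qed

section \<open>Numerical enclosure of the constant\<close>

lemma log2_ge:
  assumes "2 ^ p \<le> (x :: real) ^ q" "q > 0" "x > 0"
  shows "p / q \<le> log 2 x"
proof -
  have "real p = log 2 (2 ^ p)" by simp
  also have "\<dots> \<le> log 2 (x ^ q)" using assms by (intro log_mono) auto
  also have "\<dots> = q * log 2 x" using assms by (simp add: log_nat_power)
  finally show ?thesis using assms by (simp add: field_simps)
qed

lemma log2_le:
  assumes "(x :: real) ^ q \<le> 2 ^ p" "q > 0" "x > 0"
  shows "log 2 x \<le> p / q"
proof -
  have "q * log 2 x = log 2 (x ^ q)" using assms by (simp add: log_nat_power)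
  also have "\<dots> \<le> log 2 (2 ^ p)" using assms by (intro log_mono) auto
  finally show ?thesis using assms by (simp add: field_simps)
qed

lemma ln2_bounds: "ln (2::real) \<in> {0.6930..0.69316}"
  using ln_approx_bounds[of 2 4] by (simp add: eval_nat_numeral)

lemma c_RMQ_numeric: "1.736 \<le> c_RMQ" "c_RMQ < 1.737"
proof -
  define l3 l5 l7 l11 :: real where "l3 = log 2 3" and "l5 = log 2 5" and "l7 = log 2 7" and "l11 = log 2 11"
  \<comment> \<open>Rational bounds on logarithms of primes, certified by comparing integer powers
    such as \<open>2 ^ 84 \<le> 3 ^ 53\<close>.\<close>
  have lower: "84 / 53 \<le> l3" "65 / 28 \<le> l5" "160 / 57 \<le> l7" "83 / 24 \<le> l11"
    using log2_ge[of 84 3 53] log2_ge[of 65 5 28] log2_ge[of 160 7 57] log2_ge[of 83 11 24]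
    by (simp_all add: l3_def l5_def l7_def l11_def)
  have upper: "l3 \<le> 65 / 41" "l5 \<le> 72 / 31" "l7 \<le> 73 / 26" "l11 \<le> 128 / 37"
    using log2_le[of 3 41 65] log2_le[of 5 31 72] log2_le[of 7 26 73] log2_le[of 11 37 128]
    by (simp_all add: l3_def l5_def l7_def l11_def)
  have logs: "log 2 (3::real) = l3" "log 2 (4::real) = 2" "log 2 (5::real) = l5" "log 2 (6::real) = 1 + l3"
    "log 2 (7::real) = l7" "log 2 (8::real) = 3" "log 2 (9::real) = 2 * l3" "log 2 (10::real) = 1 + l5"
    "log 2 (11::real) = l11" "log 2 (12::real) = 2 + l3"
    using log_mult_pos[of 2 3 2] log_mult_pos[of 2 5 2] log_mult_pos[of 4 3 2] log_nat_power[of 2 2 2]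
      log_nat_power[of 2 2 3] log_nat_power[of 3 2 2]
    by (simp_all add: l3_def l5_def l7_def l11_def)
  define r where "r = 1 / ln (2::real)"
  have r: "14426 / 10000 \<le> r" "r \<le> 14431 / 10000"
    unfolding r_def using ln2_bounds by (auto simp: divide_simps)
  have "tail_lower 12 = (2 + l3) / 13 + 4 / 51 * r" "tail_upper 12 = (2 + l3) / 13 + (1 / 48 + 3 / 52) * r"
    by (simp_all add: tail_lower_def tail_upper_def logs r_def)
  moreover have "(\<Sum>k<11. c_term k) = 1 / 12 + l3 / 20 + 2 / 30 + l5 / 42 + (1 + l3) / 56 + l7 / 72
      + 3 / 90 + 2 * l3 / 110 + (1 + l5) / 132 + l11 / 156"
    by (simp add: eval_nat_numeral c_term_def logs)
  moreover have "2 * ((\<Sum>k<11. c_term k) + tail_lower 12) \<le> c_RMQ"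
    "c_RMQ \<le> 2 * ((\<Sum>k<11. c_term k) + tail_upper 12)"
    using c_RMQ_bounds[of 11] by simp_all
  ultimately have "1736 / 1000 \<le> c_RMQ \<and> c_RMQ < 1737 / 1000"
    using r lower upper by argo
  then show "1.736 \<le> c_RMQ" "c_RMQ < 1.737" by simp_all
qed

section \<open>Expected code length\<close>

lemma dominated_eq_tops:
  assumes "(a, b) \<in> intervals 1 n"
  shows "{A \<in> space (random_array n). dominated A 1 n (a, b)} =
    tops n ({a..b} \<union> border 1 n (a, b)) (border 1 n (a, b))"
proof -
  have "({a..b} \<union> border 1 n (a, b)) - border 1 n (a, b) = {a..b}"
    by (auto simp: border_def)
  then show ?thesis unfolding tops_def dominated_def by simp
qed

lemma Suc_Suc_choose_two: "real (Suc (Suc k) choose 2) = real (Suc k) * real (Suc (Suc k)) / 2"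
  by (induction k) (simp_all add: numeral_2_eq_2 field_simps)

text \<open>The three cases are the reciprocals of \<open>k + j choose j\<close> for a border with
  \<open>j\<close> = 0, 1 or 2 elements.\<close>

definition dominated_bound :: "nat \<Rightarrow> nat \<times> nat \<Rightarrow> real" where
  "dominated_bound n = (\<lambda>(a, b). let k = Suc b - a in
     if a = 1 \<and> b = n then 1 else if a = 1 \<or> b = n then 1 / (k + 1) else 2 / ((k + 1) * (k + 2)))"

lemma
  assumes "(a, b) \<in> intervals 1 n"
  shows sets_dominated: "{A \<in> space (random_array n). dominated A 1 n (a, b)} \<in> sets (random_array n)" (is ?sets)
    and measure_dominated_le:
      "measure (random_array n) {A \<in> space (random_array n). dominated A 1 n (a, b)} \<le> dominated_bound n (a, b)" (is ?le)
proof -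
  let ?B = "border 1 n (a, b)" and ?S = "{a..b} \<union> border 1 n (a, b)"
  have ab: "1 \<le> a" "a \<le> b" "b \<le> n" using assms by (auto simp: intervals_def)
  have S: "?S \<subseteq> {1..n}" using ab by (auto simp: border_def)
  have disj: "{a..b} \<inter> ?B = {}" by (auto simp: border_def)
  have B: "?B = (if 1 < a then {a - 1} else {}) \<union> (if b < n then {Suc b} else {})"
    using ab by (auto simp: border_def)
  then have "finite ?B" by simp
  then have cardS: "card ?S = Suc b - a + card ?B" using disj by (simp add: card_Un_disjoint)
  have "card ?B = (if a = 1 then 0 else 1) + (if b = n then 0 else 1)"
    unfolding B using ab by auto
  moreover obtain k where k: "b = a + k" using ab(2) le_Suc_ex by blast
  then have len: "Suc b - a = Suc k" by simp
  ultimately have bound: "1 / real (card ?S choose card ?B) = dominated_bound n (a, b)"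
    unfolding cardS len dominated_bound_def prod.case using ab
    by (cases "a = 1"; cases "b = n")
      (simp_all add: Let_def len Suc_Suc_choose_two numeral_2_eq_2[symmetric] del: binomial_Suc_Suc,
       simp_all add: algebra_simps)
  show ?sets unfolding dominated_eq_tops[OF assms] by (rule sets_tops[OF S]) simp
  show ?le unfolding dominated_eq_tops[OF assms] bound[symmetric] by (rule measure_tops_le[OF S]) simp
qed

text \<open>There are \<open>m - k - 1\<close> inner intervals of length \<open>k + 1\<close>, and
  the two at the ends contribute \<open>1 / (k + 2)\<close> each. Over the common denominator
  \<open>k\<close> cancels from the numerator, so every length yields its series term times the same
  factor.\<close>

lemma sum_dominated_bound_length:
  assumes "k < m"
  shows "(\<Sum>j<Suc m - k. dominated_bound (Suc m) (Suc j, Suc (j + k))) =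
    2 * real (m + 2) / (real (k + 2) * real (k + 3))"
proof -
  define p where "p = m - k - 1"
  have m: "m = Suc (p + k)" using assms by (simp add: p_def)
  have "(\<Sum>j<Suc m - k. dominated_bound (Suc m) (Suc j, Suc (j + k))) =
    (\<Sum>j<Suc (Suc p). dominated_bound (Suc m) (Suc j, Suc (j + k)))"
    by (simp add: m)
  also have "\<dots> = dominated_bound (Suc m) (1, Suc k) +
    (\<Sum>j<p. dominated_bound (Suc m) (Suc (Suc j), Suc (Suc j + k))) + dominated_bound (Suc m) (Suc (Suc p), Suc m)"
    by (subst sum.lessThan_Suc, subst sum.lessThan_Suc_shift) (simp add: m)
  also have "(\<Sum>j<p. dominated_bound (Suc m) (Suc (Suc j), Suc (Suc j + k))) =
     (\<Sum>j<p. 2 / (real (k + 2) * real (k + 3)))"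
    by (intro sum.cong refl) (simp add: dominated_bound_def m algebra_simps)
  also have "dominated_bound (Suc m) (1, Suc k) = 1 / real (k + 2)"
    by (simp add: dominated_bound_def m)
  also have "dominated_bound (Suc m) (Suc (Suc p), Suc m) = 1 / real (k + 2)"
    by (simp add: dominated_bound_def m)
  finally show ?thesis by (simp add: m divide_simps) (simp add: algebra_simps)
qed

lemma sum_dominated_bound_le:
  assumes "n \<ge> 1"
  shows "(\<Sum>(a, b)\<in>intervals 1 n. dominated_bound n (a, b) * log 2 (real (Suc b - a)))
    \<le> c_RMQ * (real n + 1) + log 2 (real n)"
proof -
  obtain m where n: "n = Suc m" using assms by (cases n) auto
  have "(\<Sum>(a, b)\<in>intervals 1 n. dominated_bound n (a, b) * log 2 (real (Suc b - a))) =
    (\<Sum>(k, j)\<in>(SIGMA k:{..<n}. {..<n - k}). dominated_bound n (Suc j, Suc (j + k)) * log 2 (real (Suc k)))"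
    by (rule sum.reindex_bij_witness[where j = "\<lambda>(a, b). (b - a, a - 1)" and i = "\<lambda>(k, j). (Suc j, Suc (j + k))"])
      (auto simp: intervals_def Suc_diff_le)
  also have "\<dots> = (\<Sum>k<n. (\<Sum>j<n - k. dominated_bound n (Suc j, Suc (j + k))) * log 2 (real (Suc k)))"
    by (subst sum.Sigma[symmetric]) (simp_all add: sum_distrib_right)
  \<comment> \<open>The length \<open>k = m\<close> belongs to the whole array alone, which is
    dominated with certainty and costs \<open>log 2 n\<close>.\<close>
  also have "\<dots> = (\<Sum>k<m. (\<Sum>j<Suc m - k. dominated_bound (Suc m) (Suc j, Suc (j + k))) * log 2 (real (Suc k)))
      + log 2 (real n)"
    by (simp add: n dominated_bound_def)
  also have "(\<Sum>k<m. (\<Sum>j<Suc m - k. dominated_bound (Suc m) (Suc j, Suc (j + k))) * log 2 (real (Suc k))) =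
      (\<Sum>k<m. (2 * (real n + 1)) * c_term k)"
  proof (intro sum.cong refl)
    fix k assume "k \<in> {..<m}"
    then have "k < m" by simp
    show "(\<Sum>j<Suc m - k. dominated_bound (Suc m) (Suc j, Suc (j + k))) * log 2 (real (Suc k)) =
      2 * (real n + 1) * c_term k"
      unfolding sum_dominated_bound_length[OF \<open>k < m\<close>] by (simp add: c_term_def n add_ac)
  qed
  also have "\<dots> = 2 * (real n + 1) * (\<Sum>k<m. c_term k)" by (simp add: sum_distrib_left)
  also have "\<dots> \<le> 2 * (real n + 1) * (\<Sum>k. c_term k)"
    by (intro mult_left_mono sum_le_suminf summable_c_term) (auto simp: c_term_nonneg)
  finally show ?thesis by (simp add: c_RMQ_def mult_ac)
qed

lemma expectation_dominated_le:
  fixes n :: nat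
  assumes "n \<ge> 1"
  shows "(\<integral>\<^sup>+ A. ennreal (2 + (\<Sum>(a, b)\<in>{I \<in> intervals 1 n. dominated A 1 n I}. log 2 (real (Suc b - a)))) \<partial>random_array n)
    \<le> ennreal (c_RMQ * (real n + 1) + log 2 (real n) + 2)"
proof -
  interpret prob_space "random_array n" by (rule prob_space_random_array)
  define D where "D I = {A \<in> space (random_array n). dominated A 1 n I}" for I
  define w where "w = (\<lambda>(a, b). log 2 (real (Suc b - a)))"
  have w: "w I \<ge> 0" if "I \<in> intervals 1 n" for I using that by (auto simp: w_def intervals_def)
  have sets: "D I \<in> events" and le: "prob (D I) \<le> dominated_bound n I" if "I \<in> intervals 1 n" for I
    using that sets_dominated measure_dominated_le by (cases I; simp add: D_def)+
  \<comment> \<open>Indicators turn the random index set into a fixed one, so that expectation and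
    sum can be exchanged.\<close>
  let ?g = "\<lambda>A. 2 + (\<Sum>I\<in>intervals 1 n. w I * indicator (D I) A :: real)"
  have int: "integrable (random_array n) (\<lambda>A. w I * indicator (D I) A)" if "I \<in> intervals 1 n" for I
    using sets[OF that] by (intro integrable_mult_right integrable_real_indicator) (auto simp: emeasure_eq_measure)
  have "(\<integral>\<^sup>+ A. ennreal (2 + (\<Sum>(a, b)\<in>{I \<in> intervals 1 n. dominated A 1 n I}. log 2 (real (Suc b - a)))) \<partial>random_array n)
    = (\<integral>\<^sup>+ A. ennreal (?g A) \<partial>random_array n)"
  proof (rule nn_integral_cong)
    fix A assume A: "A \<in> space (random_array n)"
    have "(\<Sum>I\<in>{I \<in> intervals 1 n. dominated A 1 n I}. w I) = (\<Sum>I\<in>intervals 1 n. if dominated A 1 n I then w I else 0)"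
      by (rule sum.inter_filter[OF finite_intervals])
    also have "\<dots> = (\<Sum>I\<in>intervals 1 n. w I * indicator (D I) A)"
      using A by (intro sum.cong) (auto simp: D_def)
    finally show "ennreal (2 + (\<Sum>(a, b)\<in>{I \<in> intervals 1 n. dominated A 1 n I}. log 2 (real (Suc b - a)))) = ennreal (?g A)"
      by (simp add: w_def)
  qed
  also have "\<dots> = ennreal (\<integral>A. ?g A \<partial>random_array n)"
    using int w by (intro nn_integral_eq_integral) (auto intro!: AE_I2 add_nonneg_nonneg sum_nonneg)
  also have "(\<integral>A. ?g A \<partial>random_array n) = 2 + (\<Sum>I\<in>intervals 1 n. w I * prob (D I))"
    using int sets by (simp add: prob_space Bochner_Integration.integral_add Bochner_Integration.integral_sum)
  also have "\<dots> \<le> 2 + (\<Sum>I\<in>intervals 1 n. w I * dominated_bound n I)"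
    using w le by (intro add_left_mono sum_mono mult_left_mono) auto
  also have "(\<Sum>I\<in>intervals 1 n. w I * dominated_bound n I) =
      (\<Sum>(a, b)\<in>intervals 1 n. dominated_bound n (a, b) * log 2 (real (Suc b - a)))"
    by (intro sum.cong) (auto simp: w_def)
  also have "2 + \<dots> \<le> c_RMQ * (real n + 1) + log 2 (real n) + 2"
    using sum_dominated_bound_le[OF assms] by simp
  finally show ?thesis by (simp add: ennreal_leI)
qed

section \<open>The encoding and its expected length\<close>

lemma pred_cartesian:
  assumes "1 \<le> i" "i + size t \<le> Suc n"
  shows "Measurable.pred (random_array n) (\<lambda>A. cartesian A i t)"
  using assms
proof (induction t arbitrary: i)
  case (Node l u r)
  then show ?case
    by (auto intro!: pred_intros_logic pred_intros_finite pred_less_random_array)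
qed simp

text \<open>Shannon code lengths with one extra bit, which keeps words nonempty even for a shape of
  weight 1, as unique decodability requires. Kraft's inequality holds because the weights add up to
  1.\<close>

lemma shannon_code:
  obtains code :: "unit tree \<Rightarrow> bool list" where
    "\<And>t. t \<in> shapes n \<Longrightarrow> length (code t) = Suc (nat \<lceil>- log 2 (weight t)\<rceil>)"
    "\<And>s t. s \<in> shapes n \<Longrightarrow> t \<in> shapes n \<Longrightarrow> prefix (code s) (code t) \<Longrightarrow> s = t"
proof -
  let ?len = "\<lambda>t. Suc (nat \<lceil>- log 2 (weight t)\<rceil>)"
  have "(1 / 2 :: real) ^ ?len t \<le> weight t" for t
  proof -
    have "(1 / 2 :: real) ^ ?len t = 2 powr (- real (?len t))"
      by (simp add: powr_minus powr_realpow power_one_over inverse_eq_divide del: power_Suc of_nat_Suc)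
    also have "\<dots> \<le> 2 powr log 2 (weight t)"
      by (intro powr_mono) linarith+
    also have "\<dots> = weight t" using weight_pos[of t] by simp
    finally show ?thesis .
  qed
  then have "(\<Sum>t\<in>shapes n. (1 / 2) ^ ?len t) \<le> (1 :: real)"
    using sum_mono[of "shapes n" "\<lambda>t. (1 / 2) ^ ?len t" weight] by (simp only: sum_weight)
  from kraft_prefix_code[OF finite_shapes this] show ?thesis using that by blast
qed

lemma expected_effective_entropy_le:
  assumes "n \<ge> 1"
  shows "expected_effective_entropy n (two_sided_queries n)
    \<le> ennreal (c_RMQ * (real n + 1) + log 2 (real n) + 2)"
proof -
  obtain code :: "unit tree \<Rightarrow> bool list" where
    len: "\<And>t. t \<in> shapes n \<Longrightarrow> length (code t) = Suc (nat \<lceil>- log 2 (weight t)\<rceil>)"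
    and prefix_free: "\<And>s t. s \<in> shapes n \<Longrightarrow> t \<in> shapes n \<Longrightarrow> prefix (code s) (code t) \<Longrightarrow> s = t"
    using shannon_code[of n] by blast
  define P where "P t A \<longleftrightarrow> t \<in> shapes n \<and> cartesian A 1 t" for t A
  \<comment> \<open>Arrays without a Cartesian tree have repeated entries; the empty word keeps them free of cost.\<close>
  define e where "e A = (if \<exists>t\<in>shapes n. P t A then code (THE t. P t A) else [])" for A
  have unique: "s = t" if "P s A" "P t A" for s t A
    using that cartesian_unique[of A 1 s t] unfolding P_def by simp
  then have e_eq: "e A = code t" if "P t A" for A t
  proof -
    have "(THE t. P t A) = t" using that unique by (intro the_equality)
    moreover have "\<exists>t\<in>shapes n. P t A" using that unfolding P_def by auto
    ultimately show ?thesis unfolding e_def by simp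
  qed
  have pred: "Measurable.pred (random_array n) (P t)" for t
    unfolding P_def using pred_cartesian[of 1 t n] by (cases "size t = n") auto
  have "e \<in> measurable (random_array n) (count_space UNIV)"
    unfolding e_def
  \<comment> \<open>The word depends on \<open>A\<close> only through the finitely many measurable
    events \<open>P t\<close>.\<close>
  proof (rule measurable_If)
    show "(\<lambda>A. code (THE t. P t A)) \<in> measurable (random_array n) (count_space UNIV)"
      using countable_finite[OF finite_shapes] unique
      by (intro measurable_compose[OF measurable_THE[where I = "shapes n", OF pred]]) (auto simp: P_def)
    show "{A \<in> space (random_array n). \<exists>t\<in>shapes n. P t A} \<in> sets (random_array n)"
      using pred by (intro sets.sets_Collect_finite_Ex predE finite_shapes)
  qed simp
  moreover have arrays: "\<exists>t. P t A" if "A \<in> arrays n" for A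
    using cartesian_exists[of A 1 n] that
    by (auto simp: P_def arrays_def atLeastLessThanSuc_atLeastAtMost)
  have "uniquely_decodable (e ` arrays n)"
  proof (rule uniquely_decodable_prefix_code)
    have e_code: "\<exists>t\<in>shapes n. u = code t" if u: "u \<in> e ` arrays n" for u
    proof -
      obtain A where "A \<in> arrays n" "u = e A" using u by blast
      moreover from this obtain t where "P t A" using arrays by blast
      ultimately show ?thesis using e_eq[of t A] by (auto simp: P_def)
    qed
    show "u = v" if "u \<in> e ` arrays n" "v \<in> e ` arrays n" "prefix u v" for u v
      using e_code[OF that(1)] e_code[OF that(2)] prefix_free that(3) by blast
    show "[] \<notin> e ` arrays n"
      using e_code[of "[]"] len by fastforce
  qed
  moreover have "\<exists>d. \<forall>A\<in>arrays n. \<forall>q\<in>two_sided_queries n. d (e A) q = rmq A q"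
  proof (intro exI ballI)
    fix A q assume A: "A \<in> arrays n" and q: "q \<in> two_sided_queries n"
    obtain t where t: "P t A" using arrays[OF A] by blast
    have "inj_on code (shapes n)"
      by (intro inj_onI prefix_free) simp_all
    then have "the_inv_into (shapes n) code (e A) = t"
      using t by (simp add: e_eq[OF t] the_inv_into_f_f P_def)
    then show "shape_rmq 1 (the_inv_into (shapes n) code (e A)) q = rmq A q"
      using shape_rmq_eq_rmq[of A 1 t] t q by (auto simp: P_def two_sided_queries_def)
  qed
  ultimately have "e \<in> encodings n (two_sided_queries n)"
    unfolding encodings_def by blast
  then have "expected_effective_entropy n (two_sided_queries n) \<le> (\<integral>\<^sup>+ A. of_nat (length (e A)) \<partial>random_array n)"
    unfolding expected_effective_entropy_def by (rule INF_lower)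
  also have "\<dots> \<le> (\<integral>\<^sup>+ A. ennreal (2 + (\<Sum>(a, b)\<in>{I \<in> intervals 1 n. dominated A 1 n I}. log 2 (real (Suc b - a)))) \<partial>random_array n)"
  proof (rule nn_integral_mono)
    fix A
    let ?L = "\<Sum>(a, b)\<in>{I \<in> intervals 1 n. dominated A 1 n I}. log 2 (real (Suc b - a))"
    have L: "?L \<ge> 0" by (intro sum_nonneg) (auto simp: intervals_def)
    \<comment> \<open>The 2 pays for rounding up and for the extra bit.\<close>
    have "real (length (e A)) \<le> 2 + ?L"
    proof (cases "\<exists>t. P t A")
      case True
      then obtain t where t: "P t A" by blast
      then have "real (length (e A)) = real (Suc (nat \<lceil>?L\<rceil>))"
        using len[of t] log_weight[of A 1 t] by (simp add: e_eq P_def)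
      then show ?thesis using L by linarith
    next
      case False
      then have "e A = []" unfolding e_def by auto
      then show ?thesis using L by simp
    qed
    then show "of_nat (length (e A)) \<le> ennreal (2 + ?L)"
      unfolding ennreal_of_nat_eq_real_of_nat by (rule ennreal_leI)
  qed
  also have "\<dots> \<le> ennreal (c_RMQ * (real n + 1) + log 2 (real n) + 2)"
    by (rule expectation_dominated_le[OF assms])
  finally show ?thesis .
qed

theorem theorem1:
  "summable c_term \<and> 1.736 \<le> c_RMQ \<and> c_RMQ < 1.737 \<and>
   (\<exists>f :: nat \<Rightarrow> real. f \<in> O(\<lambda>n. log 2 (real n)) \<and>
      (\<forall>n\<ge>1. expected_effective_entropy n (two_sided_queries n)
               \<le> ennreal (c_RMQ * real n + f n)))"
proof (intro conjI exI allI impI)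
  \<comment> \<open>The summand \<open>c_RMQ\<close> comes from the factor \<open>n + 1\<close>;
    being asymptotic, the bound is not affected by \<open>log 2 1 = 0\<close>.\<close>
  show "(\<lambda>n. c_RMQ + log 2 (real n) + 2) \<in> O(\<lambda>n. log 2 (real n))"
    by real_asymp
  show "expected_effective_entropy n (two_sided_queries n)
      \<le> ennreal (c_RMQ * real n + (c_RMQ + log 2 (real n) + 2))" if "n \<ge> 1" for n
    using expected_effective_entropy_le[OF that] by (simp add: algebra_simps)
qed (use summable_c_term c_RMQ_numeric in auto)

end
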